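(* Let $a,b$ be coprime positive integers and fix $k$ with $0\le k<b$. (a) For each path $P\in\mathcal{P}$, there is exactly one $k$-skeletal path $Q$ such that $Q=P_v$ for some lattice point $v$ on $P$. (b) The number of $k$-skeletal paths in $\mathcal{P}$ is $\frac{1}{a+b}\binom{a+b}{a}$. (c) For each labeled path $Q$ from $(0,0)$ to $(a,b)$ whose last step is an east step, there is exactly one cyclic shift of $Q$ (as a sequence of east steps and labeled north steps) that is a $k$-skeletal labeled path. (d) The number of $k$-skeletal labeled paths is $a^{b-1}$.
   Context: Let $\mathcal{P}$ be the set of lattice paths from $(0,0)$ to $(a,b)$ consisting of $b$ unit north steps and $a$ unit east steps. The level of a lattice point $(x,y)$ is $ay-bx$. For $Q\in\mathcal{P}$ and a lattice point $v$ on $Q$, the cyclic shift $Q_v$ is the path starting at the origin whose steps are the steps of $Q$ from $v$ to $(a,b)$ followed by the steps of $Q$ from $(0,0)$ to $v$. For $0\le k<b$, a path $Q\in\mathcal{P}$ is $k$-skeletal if (R1) the last $k+1$ north steps of $Q$ start at points of level $\ge 0$ (on or above the line $bx=ay$), and (R2) for every lattice point $v$ on $Q$ of level $>0$, condition (R1) fails for $Q_v$. A labeled path is a path in $\mathcal{P}$ together with a bijective assignment of the labels $1,\dots,b$ to its north steps such that, within each maximal run of consecutive north steps, labels increase from bottom to top. A labeled path is $k$-skeletal if its underlying unlabeled path is. When cyclically shifting a labeled path, labels move with their north steps. *)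

theory Defs
  imports Complex_Main
begin

(* Unlabeled paths are lists of unit steps whose north steps carry the trivial label (); labeled
   paths carry natural numbers. All paths start at the origin. *)
datatype 'l step = East | is_North: North (label: 'l)

definition point_at :: "'l step list \<Rightarrow> nat \<Rightarrow> nat \<times> nat" where
  "point_at Q i = (length (filter (\<lambda>s. \<not> is_North s) (take i Q)),
                   length (filter is_North (take i Q)))"

definition lattice_points :: "'l step list \<Rightarrow> (nat \<times> nat) set" where
  "lattice_points Q = point_at Q ` {0..length Q}"

definition lattice_paths :: "nat \<Rightarrow> nat \<Rightarrow> unit step list set" where
  "lattice_paths a b = {Q. point_at Q (length Q) = (a, b)}"

definition level :: "nat \<Rightarrow> nat \<Rightarrow> nat \<times> nat \<Rightarrow> int" where
  "level a b v = int a * int (snd v) - int b * int (fst v)"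

(* A lattice point (x, y) on a path is reached after exactly x + y steps. *)
definition cyclic_shift :: "'l step list \<Rightarrow> nat \<times> nat \<Rightarrow> 'l step list" where
  "cyclic_shift Q v = drop (fst v + snd v) Q @ take (fst v + snd v) Q"

definition north_positions :: "'l step list \<Rightarrow> nat list" where
  "north_positions Q = filter (\<lambda>i. is_North (Q ! i)) [0..<length Q]"

definition R1 :: "nat \<Rightarrow> nat \<Rightarrow> nat \<Rightarrow> unit step list \<Rightarrow> bool" where
  "R1 a b k Q \<longleftrightarrow>
     (\<forall>i \<in> set (take (k + 1) (rev (north_positions Q))). level a b (point_at Q i) \<ge> 0)"

definition R2 :: "nat \<Rightarrow> nat \<Rightarrow> nat \<Rightarrow> unit step list \<Rightarrow> bool" where
  "R2 a b k Q \<longleftrightarrow>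
     (\<forall>v \<in> lattice_points Q. level a b v > 0 \<longrightarrow> \<not> R1 a b k (cyclic_shift Q v))"

definition skeletal :: "nat \<Rightarrow> nat \<Rightarrow> nat \<Rightarrow> unit step list \<Rightarrow> bool" where
  "skeletal a b k Q \<longleftrightarrow> Q \<in> lattice_paths a b \<and> R1 a b k Q \<and> R2 a b k Q"

definition underlying :: "nat step list \<Rightarrow> unit step list" where
  "underlying Q = map (map_step (\<lambda>_. ())) Q"

(* Two north steps at positions i < j lie in a common maximal run of north steps iff every step
   at a position in {i..j} is a north step. *)
definition labeled_paths :: "nat \<Rightarrow> nat \<Rightarrow> nat step list set" where
  "labeled_paths a b = {Q.
     underlying Q \<in> lattice_paths a b \<and>
     bij_betw (\<lambda>i. label (Q ! i)) {i. i < length Q \<and> is_North (Q ! i)} {1..b} \<and>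
     (\<forall>i j. i < j \<and> j < length Q \<and> (\<forall>m \<in> {i..j}. is_North (Q ! m)) \<longrightarrow>
        label (Q ! i) < label (Q ! j))}"

definition skeletal_labeled :: "nat \<Rightarrow> nat \<Rightarrow> nat \<Rightarrow> nat step list \<Rightarrow> bool" where
  "skeletal_labeled a b k Q \<longleftrightarrow> Q \<in> labeled_paths a b \<and> skeletal a b k (underlying Q)"

end

theory Submission imports Defs "HOL-Number_Theory.Cong" begin

text \<open>Number the lattice points of a path cyclically by positions \<open>j < a + b\<close>. Starting the path
  at \<open>j\<close> lowers all levels by the level of \<open>j\<close>, so the shift at \<open>j\<close> is skeletal iff \<open>j\<close> has
  maximal level among the positions whose shift satisfies (R1). Such positions exist, since the
  position of minimal level is one, and by coprimality distinct positions have distinct levels;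
  hence exactly one position is skeletal. Counting pairs (skeletal path, rotation) then gives (b).
  For (d), a skeletal path ends with an east step, so exactly \<open>a\<close> of its rotations
  end with an east step, and the labeled paths ending with an east step correspond to the
  \<open>a ^ b\<close> maps from labels to columns.\<close>

section \<open>Levels and rotations\<close>

lemma not_is_North_iff: "\<not> is_North s \<longleftrightarrow> s = East"
  by (cases s) auto

lemma length_filter_not: "length (filter (\<lambda>s. \<not> P s) xs) + length (filter P xs) = length xs"
  using sum_length_filter_compl[of P xs] by simp

text \<open>The coordinates of the point reached after \<open>i\<close> steps add up to
  \<open>i\<close>, so the shift cuts the list at position \<open>i\<close>. This turns shifts at
  points into \<open>rotate\<close>.\<close>

lemma cyclic_shift_point_at:
  assumes "i \<le> length P"
  shows "cyclic_shift P (point_at P i) = rotate i P"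
proof -
  have "fst (point_at P i) + snd (point_at P i) = i"
    using assms length_filter_not[of is_North "take i P"] by (simp add: point_at_def)
  then have "cyclic_shift P (point_at P i) = drop i P @ take i P"
    by (simp add: cyclic_shift_def)
  also have "\<dots> = rotate i P"
    using assms by (cases "i = length P") (auto simp: rotate_drop_take)
  finally show ?thesis .
qed

text \<open>The end point and the origin give the same shift, so positions below
  \<open>length P\<close> cover all lattice points.\<close>

lemma ex_cyclic_shift_iff:
  assumes "P \<noteq> []"
  shows "(\<exists>v \<in> lattice_points P. R = cyclic_shift P v) \<longleftrightarrow> (\<exists>j < length P. R = rotate j P)"
proof
  assume "\<exists>v \<in> lattice_points P. R = cyclic_shift P v"
  then obtain i where "R = rotate i P"
    by (auto simp: lattice_points_def cyclic_shift_point_at)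
  then show "\<exists>j < length P. R = rotate j P"
    using assms by (intro exI[of _ "i mod length P"]) (simp flip: rotate_conv_mod)
next
  assume "\<exists>j < length P. R = rotate j P"
  then show "\<exists>v \<in> lattice_points P. R = cyclic_shift P v"
    by (force simp: lattice_points_def cyclic_shift_point_at)
qed

lemma length_filter_rotate [simp]: "length (filter P (rotate j xs)) = length (filter P xs)"
  unfolding rotate_drop_take
  by (metis add.commute append_take_drop_id filter_append length_append)

lemma lattice_paths_iff:
  "P \<in> lattice_paths a b \<longleftrightarrow>
     length (filter (\<lambda>s. \<not> is_North s) P) = a \<and> length (filter is_North P) = b"
  by (auto simp: lattice_paths_def point_at_def)

lemma lattice_paths_length: "P \<in> lattice_paths a b \<Longrightarrow> length P = a + b"
  using length_filter_not[of is_North P] by (auto simp: lattice_paths_iff)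

lemma rotate_lattice_paths_iff [simp]: "rotate j P \<in> lattice_paths a b \<longleftrightarrow> P \<in> lattice_paths a b"
  by (simp add: lattice_paths_iff)

text \<open>A north step raises the level by \<open>a\<close>, an east step lowers it by
  \<open>b\<close>. As a sum over steps, the level is additive under concatenation.\<close>

lemma level_eq_sum_list:
  "level a b (point_at Q i) = (\<Sum>s\<leftarrow>take i Q. if is_North s then int a else - int b)"
proof -
  have "level a b (length (filter (\<lambda>s. \<not> is_North s) xs), length (filter is_North xs))
          = (\<Sum>s\<leftarrow>xs. if is_North s then int a else - int b)" for xs :: "'a step list"
    by (induction xs) (auto simp: level_def algebra_simps)
  then show ?thesis by (simp add: point_at_def)
qed

lemma level_end: "P \<in> lattice_paths a b \<Longrightarrow> level a b (point_at P (a + b)) = 0"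
  by (simp add: lattice_paths_def level_def lattice_paths_length[symmetric])

text \<open>The level returns to 0 at the end of \<open>P\<close>, so it extends periodically along
  the repeated path; a new origin at \<open>j\<close> subtracts the level there.\<close>

lemma level_rotate:
  assumes P: "P \<in> lattice_paths a b" and j: "j < a + b" and i: "i \<le> a + b"
  shows "level a b (point_at (rotate j P) i)
           = level a b (point_at P ((j + i) mod (a + b))) - level a b (point_at P j)"
proof -
  have len: "length P = a + b" using P by (rule lattice_paths_length)
  have rot: "rotate j P = drop j P @ take j P" using j len by (simp add: rotate_drop_take)
  define f :: "unit step list \<Rightarrow> int"
    where "f xs = (\<Sum>s\<leftarrow>xs. if is_North s then int a else - int b)" for xs
  have f_append: "f (xs @ ys) = f xs + f ys" for xs ys by (simp add: f_def)
  have lev: "level a b (point_at Q i) = f (take i Q)" for Q i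
    by (simp add: f_def level_eq_sum_list)
  have f_P: "f P = 0" using level_end[OF P] len by (simp add: lev)
  show ?thesis
  proof (cases "j + i \<le> a + b")
    case True
    have "f (take (j + i) P) = f (take j P) + f (take i (drop j P))"
      by (simp add: take_add f_append)
    \<comment> \<open>For \<open>j + i = a + b\<close> the remainder is 0, and both sides vanish
      because \<open>f P = 0\<close>.\<close>
    moreover have "f (take ((j + i) mod (a + b)) P) = f (take (j + i) P)"
      using True f_P len by (cases "j + i = a + b") (auto simp: f_def)
    ultimately show ?thesis using True len by (simp add: lev rot)
  next
    case False
    then have m: "(j + i) mod (a + b) = j + i - (a + b)"
      using i j by (simp add: le_mod_geq)
    have "f (take j P) + f (drop j P) = 0"
      using f_P by (simp flip: f_append)
    then show ?thesis
      using False len i j by (simp add: lev rot f_append m min_def) (simp add: algebra_simps)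
  qed
qed

text \<open>Modulo \<open>a + b\<close> we have a = -b, so the level after \<open>m\<close> steps is
  congruent to \<open>- b * m\<close>. Coprimality makes \<open>b\<close> invertible, and the level
  determines the position.\<close>

lemma level_inj:
  assumes P: "P \<in> lattice_paths a b" and "coprime a b"
    and i: "i < a + b" and j: "j < a + b"
    and eq: "level a b (point_at P i) = level a b (point_at P j)"
  shows "i = j"
proof -
  have len: "length P = a + b" using P by (rule lattice_paths_length)
  have lev: "[level a b (point_at P m) + int b * int m = 0] (mod int (a + b))"
    if "m < a + b" for m
  proof -
    have "m = fst (point_at P m) + snd (point_at P m)"
      using that len length_filter_not[of is_North "take m P"] by (simp add: point_at_def)
    then have "int m = int (fst (point_at P m)) + int (snd (point_at P m))" by linarith
    then have "level a b (point_at P m) + int b * int m = int (a + b) * int (snd (point_at P m))"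
      by (simp add: level_def algebra_simps)
    then show ?thesis by (simp add: cong_def)
  qed
  have "[int b * int i = int b * int j] (mod int (a + b))"
    using cong_trans[OF lev[OF i] cong_sym[OF lev[OF j]]] unfolding eq cong_add_lcancel .
  moreover have "coprime (int b) (int (a + b))"
    using \<open>coprime a b\<close>
    by (simp only: coprime_int_iff) (simp add: coprime_iff_gcd_eq_1 gcd.commute[of b])
  ultimately have "[int i = int j] (mod int (a + b))"
    by (simp add: cong_mult_lcancel)
  then have "[i = j] (mod (a + b))" by (simp only: cong_int_iff)
  then show ?thesis using i j by (rule cong_less_modulus_unique_nat)
qed

section \<open>Skeletal rotations of a path\<close>

text \<open>A point of \<open>rotate j P\<close> has positive level iff its position on
  \<open>P\<close> has larger level than \<open>j\<close>. Thus (R2) compares levels on the single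
  path \<open>P\<close>, whatever the rotation.\<close>

lemma skeletal_rotate_iff:
  assumes P: "P \<in> lattice_paths a b" and j: "j < a + b"
  shows "skeletal a b k (rotate j P) \<longleftrightarrow> R1 a b k (rotate j P) \<and>
    (\<forall>i < a + b. level a b (point_at P i) > level a b (point_at P j) \<longrightarrow> \<not> R1 a b k (rotate i P))"
proof -
  let ?n = "a + b"
  have len: "length P = ?n" using P by (rule lattice_paths_length)
  have shift: "cyclic_shift (rotate j P) (point_at (rotate j P) i) = rotate ((j + i) mod ?n) P"
    if "i \<le> ?n" for i
    using that len by (simp add: cyclic_shift_point_at rotate_rotate add.commute flip: rotate_conv_mod)
      (metis add.commute rotate_conv_mod)
  have "R2 a b k (rotate j P) \<longleftrightarrow> (\<forall>i \<le> ?n. level a b (point_at P ((j + i) mod ?n))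
      > level a b (point_at P j) \<longrightarrow> \<not> R1 a b k (rotate ((j + i) mod ?n) P))"
    using len by (auto simp: R2_def lattice_points_def shift level_rotate[OF P j])
  also have "\<dots> \<longleftrightarrow> (\<forall>i < ?n. level a b (point_at P i) > level a b (point_at P j)
      \<longrightarrow> \<not> R1 a b k (rotate i P))" (is "?A \<longleftrightarrow> ?B")
  proof
    assume A: ?A
    show ?B
    proof (intro allI impI)
      fix i assume i: "i < ?n" and lt: "level a b (point_at P i) > level a b (point_at P j)"
      \<comment> \<open>The cyclic distance from \<open>j\<close> forward to
        \<open>i\<close>.\<close>
      define m where "m = (i + (?n - j)) mod ?n"
      have "(j + m) mod ?n = (j + (i + (?n - j))) mod ?n" by (simp add: m_def mod_add_right_eq)
      also have "\<dots> = i" using i j by simp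
      finally have "(j + m) mod ?n = i" .
      moreover have "m \<le> ?n"
        unfolding m_def by (rule less_imp_le) (rule mod_less_divisor, use j in linarith)
      ultimately show "\<not> R1 a b k (rotate i P)" using A lt by blast
    qed
  next
    assume ?B
    moreover have "(j + i) mod ?n < ?n" for i using j by (intro mod_less_divisor) linarith
    ultimately show ?A by blast
  qed
  finally show ?thesis using P by (simp add: skeletal_def)
qed

text \<open>The position sought is the one of maximal level in \<open>G\<close>, the set of
  positions whose rotation satisfies (R1). Uniqueness comes from \<open>level_inj\<close>.\<close>

lemma ex1_skeletal_rotate:
  assumes P: "P \<in> lattice_paths a b" and "a > 0" and "coprime a b"
  shows "\<exists>!j. j < a + b \<and> skeletal a b k (rotate j P)"
proof -
  let ?n = "a + b" and ?L = "\<lambda>i. level a b (point_at P i)"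
  define G where "G = {j. j < ?n \<and> R1 a b k (rotate j P)}"
  have len: "length P = ?n" using P by (rule lattice_paths_length)
  have "G \<noteq> {}"
  proof -
    \<comment> \<open>Started at a position of minimal level, the path has no negative level at all,
      so (R1) holds whatever \<open>k\<close> is.\<close>
    define m where "m = arg_min_on ?L {..<?n}"
    have m: "m < ?n" "\<And>i. i < ?n \<Longrightarrow> ?L m \<le> ?L i"
      using arg_min_if_finite[of "{..<?n}" ?L] \<open>a > 0\<close>
      by (auto simp: m_def not_less lessThan_empty_iff)
    have "level a b (point_at (rotate m P) i) \<ge> 0" if "i \<le> ?n" for i
      using m \<open>a > 0\<close> by (simp add: level_rotate[OF P m(1) that])
    then have "R1 a b k (rotate m P)"
      using len by (auto simp: R1_def north_positions_def dest!: in_set_takeD)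
    then show ?thesis using m(1) by (auto simp: G_def)
  qed
  moreover have fin: "finite G" by (simp add: G_def)
  ultimately obtain j where j: "j \<in> G" "Max (?L ` G) = ?L j"
    using obtains_MAX[of G ?L] by blast
  have max: "?L i \<le> ?L j" if "i \<in> G" for i
    using that fin by (simp flip: j(2))
  show ?thesis
  proof (rule ex1I[of _ j])
    have "\<not> R1 a b k (rotate i P)" if "i < ?n" "?L i > ?L j" for i
      using max[of i] that by (auto simp: G_def)
    then show "j < ?n \<and> skeletal a b k (rotate j P)"
      using j(1) by (simp add: G_def skeletal_rotate_iff[OF P])
  next
    fix i assume i: "i < ?n \<and> skeletal a b k (rotate i P)"
    then have "i \<in> G" by (simp add: G_def skeletal_def)
    \<comment> \<open>Otherwise \<open>j\<close> would be a higher position satisfying (R1), against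
      (R2) for the rotation at \<open>i\<close>.\<close>
    moreover have "\<not> ?L i < ?L j"
      using i j(1) by (auto simp: G_def skeletal_rotate_iff[OF P])
    ultimately have "?L i = ?L j" using max by (simp add: antisym_conv2)
    moreover have "j < ?n" using j(1) by (simp add: G_def)
    ultimately show "i = j" using level_inj[OF P \<open>coprime a b\<close>] i by blast
  qed
qed

section \<open>Counting rotation orbits\<close>

text \<open>Double counting: each \<open>P\<close> in \<open>X\<close> arises as
  \<open>rotate i R\<close> from exactly one pair with \<open>K R\<close>, by undoing its unique
  good rotation. Part (b) takes all paths for \<open>X\<close>, part (d) the labeled paths ending
  with an east step.\<close>

lemma card_rotation_orbits:
  assumes "finite {R. K R}"
    and len: "\<And>P. P \<in> X \<Longrightarrow> length P = n" "\<And>R. K R \<Longrightarrow> length R = n"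
    and uniq: "\<And>P. P \<in> X \<Longrightarrow> \<exists>!j. j < n \<and> K (rotate j P)"
    and m: "\<And>R. K R \<Longrightarrow> card {i. i < n \<and> rotate i R \<in> X} = m"
  shows "card X = card {R. K R} * m"
proof -
  let ?D = "SIGMA R:{R. K R}. {i. i < n \<and> rotate i R \<in> X}"
  \<comment> \<open>The remainder keeps the inverse offset below \<open>n\<close> when
    \<open>i = 0\<close>, as \<open>uniq\<close> demands.\<close>
  have unrotate: "rotate ((n - i) mod n) (rotate i R) = R" if "i < n" "length R = n" for i R
  proof -
    have "rotate ((n - i) mod n) (rotate i R) = rotate (n - i) (rotate i R)"
      using that by (metis length_rotate rotate_conv_mod)
    then show ?thesis using that by (simp add: rotate_rotate)
  qed
  have "bij_betw (\<lambda>(R, i). rotate i R) ?D X"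
  proof (rule bij_betw_imageI)
    show "inj_on (\<lambda>(R, i). rotate i R) ?D"
    proof (intro inj_onI, clarsimp)
      fix R i R' i' assume K: "K R" "K R'" and i: "i < n" "i' < n"
        and X: "rotate i' R' \<in> X" and eq: "rotate i R = rotate i' R'"
      have R: "rotate ((n - i) mod n) (rotate i' R') = R"
        using unrotate[OF i(1) len(2)[OF K(1)]] by (simp only: eq)
      have R': "rotate ((n - i') mod n) (rotate i' R') = R'"
        using i(2) len(2)[OF K(2)] by (rule unrotate)
      have "n > 0" using i(1) by simp
      \<comment> \<open>Both offsets carry the common path \<open>rotate i' R'\<close> to a path
        satisfying \<open>K\<close>, so \<open>uniq\<close> identifies them.\<close>
      then have "(n - i) mod n = (n - i') mod n"
        using uniq[OF X] K R R' mod_less_divisor[OF \<open>n > 0\<close>] by metis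
      then have "i = i'"
        using i by (cases "i = 0"; cases "i' = 0") auto
      then show "R = R' \<and> i = i'" using R R' by simp
    qed
    show "(\<lambda>(R, i). rotate i R) ` ?D = X"
    proof (intro equalityI subsetI)
      fix P assume P: "P \<in> X"
      then obtain j where j: "j < n" "K (rotate j P)" using uniq by blast
      have "(rotate j P, (n - j) mod n) \<in> ?D"
        using j P unrotate[OF j(1) len(1)[OF P]] by auto
      then show "P \<in> (\<lambda>(R, i). rotate i R) ` ?D"
        using unrotate[OF j(1) len(1)[OF P]] by (metis (no_types, lifting) case_prod_conv image_eqI)
    qed auto
  qed
  then have "card X = card ?D" by (simp add: bij_betw_same_card)
  also have "\<dots> = card {R. K R} * m" using assms(1) m by simp
  finally show ?thesis .
qed

text \<open>The last entry of \<open>rotate i xs\<close> is the cyclic predecessor of entry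
  \<open>i\<close>, so every entry is last in exactly one rotation. Adding \<open>?n - 1\<close>
  modulo \<open>?n\<close> expresses the predecessor without truncated subtraction at 0.\<close>

lemma card_rotations_last:
  assumes "xs \<noteq> []"
  shows "card {i. i < length xs \<and> P (last (rotate i xs))} = length (filter P xs)"
proof -
  let ?n = "length xs"
  have last: "last (rotate i xs) = xs ! ((i + (?n - 1)) mod ?n)" for i
    using assms by (simp add: last_conv_nth nth_rotate)
  have "bij_betw (\<lambda>i. (i + (?n - 1)) mod ?n) {i. i < ?n \<and> P (last (rotate i xs))}
          {i. i < ?n \<and> P (xs ! i)}"
  proof (rule bij_betw_byWitness[where f' = "\<lambda>i. (i + 1) mod ?n"])
    have inv: "((i + 1) mod ?n + (?n - 1)) mod ?n = i" if "i < ?n" for i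
    proof -
      have "((i + 1) mod ?n + (?n - 1)) mod ?n = (i + 1 + (?n - 1)) mod ?n" by (rule mod_add_left_eq)
      also have "i + 1 + (?n - 1) = i + ?n" using that by simp
      finally show ?thesis using that by simp
    qed
    show "\<forall>i\<in>{i. i < ?n \<and> P (last (rotate i xs))}. ((i + (?n - 1)) mod ?n + 1) mod ?n = i"
      using assms by (auto simp: mod_simps)
    show "\<forall>i\<in>{i. i < ?n \<and> P (xs ! i)}. ((i + 1) mod ?n + (?n - 1)) mod ?n = i"
      using inv by blast
    show "(\<lambda>i. (i + 1) mod ?n) ` {i. i < ?n \<and> P (xs ! i)} \<subseteq> {i. i < ?n \<and> P (last (rotate i xs))}"
      using assms inv by (auto simp del: mod_Suc simp: last)
  qed (use assms in \<open>auto simp: last\<close>)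
  then show ?thesis by (simp add: bij_betw_same_card length_filter_conv_card)
qed

section \<open>The number of lattice paths\<close>

lemma finite_lattice_paths: "finite (lattice_paths a b)"
proof (rule finite_subset)
  have unit_step: "s = East \<or> s = North ()" for s :: "unit step" by (cases s) auto
  show "lattice_paths a b \<subseteq> {P. set P \<subseteq> {East, North ()} \<and> length P = a + b}"
    using unit_step by (auto simp: lattice_paths_length)
qed (simp add: finite_lists_length_eq)

lemma lattice_paths_0_left: "lattice_paths 0 b = {replicate b (North ())}"
proof -
  have "P = replicate b (North ())" if "P \<in> lattice_paths 0 b" for P
    using that lattice_paths_length[OF that]
    by (auto simp: lattice_paths_iff filter_empty_conv is_North_def intro!: replicate_eqI)
  then show ?thesis by (auto simp: lattice_paths_iff)
qed

lemma lattice_paths_0_right: "lattice_paths a 0 = {replicate a East}"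
proof -
  have "P = replicate a East" if "P \<in> lattice_paths a 0" for P
    using that lattice_paths_length[OF that] step.exhaust_disc
    by (auto simp: lattice_paths_iff filter_empty_conv intro!: replicate_eqI)
  then show ?thesis by (auto simp: lattice_paths_iff)
qed

lemma lattice_paths_Suc_Suc:
  "lattice_paths (Suc a) (Suc b) =
     (#) East ` lattice_paths a (Suc b) \<union> (#) (North ()) ` lattice_paths (Suc a) b"
proof (rule set_eqI)
  fix P
  show "P \<in> lattice_paths (Suc a) (Suc b) \<longleftrightarrow>
    P \<in> (#) East ` lattice_paths a (Suc b) \<union> (#) (North ()) ` lattice_paths (Suc a) b"
  proof (cases P)
    case (Cons s P')
    then show ?thesis by (cases s) (auto simp: lattice_paths_iff)
  qed (auto simp: lattice_paths_iff)
qed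

text \<open>Splitting by the first step yields Pascal's rule, used in a nested induction on
  \<open>a\<close> and \<open>b\<close>.\<close>

lemma card_lattice_paths: "card (lattice_paths a b) = (a + b) choose a"
proof (induction a arbitrary: b)
  case 0
  show ?case by (simp add: lattice_paths_0_left)
next
  case (Suc a)
  note IH = Suc.IH
  show ?case
  proof (induction b)
    case 0
    show ?case by (simp add: lattice_paths_0_right)
  next
    case (Suc b)
    have "card (lattice_paths (Suc a) (Suc b))
            = card (lattice_paths a (Suc b)) + card (lattice_paths (Suc a) b)"
      unfolding lattice_paths_Suc_Suc
      by (subst card_Un_disjoint) (auto simp: finite_lattice_paths card_image)
    then show ?case using IH Suc.IH by simp
  qed
qed

section \<open>Labeled paths\<close>

definition north_labels :: "'l step list \<Rightarrow> 'l list" where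
  "north_labels Q = map label (filter is_North Q)"

text \<open>Only adjacent steps are compared, which makes the condition easy to split at a
  concatenation; transitivity recovers the comparison of any two steps in a run.\<close>

definition increasing_runs :: "'l::linorder step list \<Rightarrow> bool" where
  "increasing_runs = successively (\<lambda>s t. is_North s \<longrightarrow> is_North t \<longrightarrow> label s < label t)"

lemma north_labels_simps [simp]:
  "north_labels [] = []"
  "north_labels (East # Q) = north_labels Q"
  "north_labels (North l # Q) = l # north_labels Q"
  "north_labels (P @ Q) = north_labels P @ north_labels Q"
  "north_labels (map North ls) = ls"
  by (auto simp: north_labels_def filter_map o_def)

lemma increasing_runs_iff_nth:
  "increasing_runs Q \<longleftrightarrow>
     (\<forall>i j. i < j \<and> j < length Q \<and> (\<forall>m \<in> {i..j}. is_North (Q ! m)) \<longrightarrow>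
        label (Q ! i) < label (Q ! j))" (is "_ \<longleftrightarrow> ?R")
proof
  assume Q: "increasing_runs Q"
  show ?R
  proof (intro allI impI, elim conjE)
    fix i j assume "i < j" "j < length Q" "\<forall>m \<in> {i..j}. is_North (Q ! m)"
    then show "label (Q ! i) < label (Q ! j)"
    proof (induction j)
      case (Suc j)
      then have *: "label (Q ! j) < label (Q ! Suc j)"
        using Q by (auto simp: increasing_runs_def successively_conv_nth)
      show ?case
      proof (cases "i = j")
        case False
        then have "label (Q ! i) < label (Q ! j)" using Suc by auto
        then show ?thesis using * by simp
      qed (use * in simp)
    qed simp
  qed
next
  assume R: ?R
  have "label (Q ! i) < label (Q ! Suc i)"
    if "Suc i < length Q" "is_North (Q ! i)" "is_North (Q ! Suc i)" for i
  proof -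
    have "is_North (Q ! m)" if "m \<in> {i..Suc i}" for m
    proof -
      have "m = i \<or> m = Suc i" using that by auto
      then show ?thesis using \<open>is_North (Q ! i)\<close> \<open>is_North (Q ! Suc i)\<close> by auto
    qed
    then show ?thesis using R that(1) by blast
  qed
  then show "increasing_runs Q"
    by (auto simp: increasing_runs_def successively_conv_nth)
qed

text \<open>Listing the north positions in order turns a statement about indices into one about the
  list of labels.\<close>

lemma bij_betw_label_iff:
  "bij_betw (\<lambda>i. label (Q ! i)) {i. i < length Q \<and> is_North (Q ! i)} S \<longleftrightarrow>
     distinct (north_labels Q) \<and> set (north_labels Q) = S"
proof -
  let ?is = "filter (\<lambda>i. is_North (Q ! i)) [0..<length Q]"
  have "filter is_North Q = filter is_North (map ((!) Q) [0..<length Q])" by (simp add: map_nth)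
  also have "\<dots> = map ((!) Q) ?is" by (simp add: filter_map o_def)
  finally have "north_labels Q = map (\<lambda>i. label (Q ! i)) ?is"
    by (simp add: north_labels_def)
  moreover have "{i. i < length Q \<and> is_North (Q ! i)} = set ?is" by auto
  ultimately show ?thesis by (simp add: bij_betw_def distinct_map)
qed

lemma underlying_rotate [simp]: "underlying (rotate j Q) = rotate j (underlying Q)"
  by (simp add: underlying_def rotate_map)

lemma length_underlying [simp]: "length (underlying Q) = length Q"
  by (simp add: underlying_def)

lemma underlying_in_lattice_paths_iff:
  "underlying Q \<in> lattice_paths a b \<longleftrightarrow>
     length (filter (\<lambda>s. \<not> is_North s) Q) = a \<and> length (north_labels Q) = b"
  by (simp add: lattice_paths_iff underlying_def north_labels_def filter_map o_def step.map_disc_iff)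

text \<open>Distinct labels with set \<open>{1..b}\<close> are \<open>b\<close> in number, so the
  count of north steps follows from the labels.\<close>

lemma labeled_paths_iff:
  "Q \<in> labeled_paths a b \<longleftrightarrow> length (filter (\<lambda>s. \<not> is_North s) Q) = a \<and>
     distinct (north_labels Q) \<and> set (north_labels Q) = {1..b} \<and> increasing_runs Q"
proof -
  have "length (north_labels Q) = b" if "distinct (north_labels Q)" "set (north_labels Q) = {1..b}"
    using distinct_card[OF that(1)] that(2) by simp
  then show ?thesis
    unfolding labeled_paths_def mem_Collect_eq bij_betw_label_iff
    by (auto simp only: increasing_runs_iff_nth underlying_in_lattice_paths_iff)
qed

lemma labeled_paths_length: "Q \<in> labeled_paths a b \<Longrightarrow> length Q = a + b"
  by (metis (lifting) labeled_paths_def lattice_paths_length length_underlying mem_Collect_eq)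

lemma finite_labeled_paths: "finite (labeled_paths a b)"
proof (rule finite_subset)
  show "labeled_paths a b \<subseteq> {Q. set Q \<subseteq> insert East (North ` {1..b}) \<and> length Q = a + b}"
  proof (intro subsetI CollectI conjI)
    fix Q s assume Q: "Q \<in> labeled_paths a b" and s: "s \<in> set Q"
    then show "s \<in> insert East (North ` {1..b})"
    proof (cases s)
      case (North l)
      then have "l \<in> set (north_labels Q)" using s by (force simp: north_labels_def)
      then show ?thesis using Q North by (simp add: labeled_paths_iff)
    qed simp
  qed (simp add: labeled_paths_length)
qed (simp add: finite_lists_length_eq)

text \<open>No run wraps around the end of a path whose last step is an east step.\<close>

lemma rotate_labeled_paths:
  assumes Q: "Q \<in> labeled_paths a b" and "last Q = East"
  shows "rotate j Q \<in> labeled_paths a b"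
proof -
  define ps qs where "ps = take (j mod length Q) Q" and "qs = drop (j mod length Q) Q"
  have rot: "rotate j Q = qs @ ps" and split: "Q = ps @ qs"
    by (simp_all add: rotate_drop_take ps_def qs_def)
  have "increasing_runs (qs @ ps)"
    using assms unfolding split
    by (auto simp: labeled_paths_iff increasing_runs_def successively_append_iff)
  moreover have "distinct (north_labels (qs @ ps))" "set (north_labels (qs @ ps)) = {1..b}"
    using Q unfolding split by (auto simp: labeled_paths_iff)
  ultimately show ?thesis
    using Q by (simp add: labeled_paths_iff flip: rot)
qed

section \<open>Labeled paths ending with an east step\<close>

definition east_ended :: "nat \<Rightarrow> 'l::linorder set \<Rightarrow> 'l step list set" where
  "east_ended a S = {Q. length (filter (\<lambda>s. \<not> is_North s) Q) = a \<and> distinct (north_labels Q) \<and>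
     set (north_labels Q) = S \<and> increasing_runs Q \<and> (Q \<noteq> [] \<longrightarrow> last Q = East)}"

lemma east_ended_0: "east_ended 0 S = (if S = {} then {[]} else {})"
proof -
  have "Q = []" if "Q \<in> east_ended 0 S" for Q
    using that last_in_set[of Q] by (auto simp: east_ended_def filter_empty_conv)
  then have "east_ended 0 S \<subseteq> {[]}" by blast
  moreover have "[] \<in> east_ended 0 S \<longleftrightarrow> S = {}" by (auto simp: east_ended_def increasing_runs_def)
  ultimately show ?thesis by auto
qed

lemma increasing_runs_map_North: "increasing_runs (map North ls) \<longleftrightarrow> sorted_wrt (<) ls"
  by (simp add: increasing_runs_def successively_map successively_conv_sorted_wrt)

lemma increasing_runs_append_East:
  "increasing_runs (P @ East # Q) \<longleftrightarrow> increasing_runs P \<and> increasing_runs Q"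
  by (auto simp: increasing_runs_def successively_append_iff successively_Cons)

text \<open>\<open>T\<close> is the set of labels before the first east step. Their order is forced
  to be increasing, and that east step separates them from the following run.\<close>

lemma east_ended_Suc:
  assumes "finite S"
  shows "east_ended (Suc a) S =
    (\<Union>T\<in>Pow S. (\<lambda>Q. map North (sorted_list_of_set T) @ East # Q) ` east_ended a (S - T))"
    (is "_ = ?R")
proof (intro equalityI subsetI)
  fix Q assume Q: "Q \<in> east_ended (Suc a) S"
  then have "filter (\<lambda>s. \<not> is_North s) Q \<noteq> []" by (auto simp: east_ended_def)
  then have ex: "\<exists>s \<in> set Q. \<not> is_North s" by (simp add: filter_empty_conv)
  define ls where "ls = map label (takeWhile is_North Q)"
  obtain Q' where split: "Q = map North ls @ East # Q'"
  proof
    have "dropWhile is_North Q \<noteq> []" using ex by (simp add: dropWhile_eq_Nil_conv)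
    then have "dropWhile is_North Q = East # tl (dropWhile is_North Q)"
      using hd_dropWhile[of is_North Q] by (metis list.collapse step.exhaust_disc)
    moreover have "map North ls = takeWhile is_North Q"
      by (auto simp: ls_def intro!: map_idI dest: set_takeWhileD)
    ultimately show "Q = map North ls @ East # tl (dropWhile is_North Q)"
      by (metis takeWhile_dropWhile_id)
  qed
  have "sorted_wrt (<) ls" and Q': "Q' \<in> east_ended a (S - set ls)" "set ls \<subseteq> S"
    using Q by (auto simp: east_ended_def split increasing_runs_append_East
        increasing_runs_map_North filter_map o_def split: if_splits)
  then have "sorted_list_of_set (set ls) = ls"
    by (simp add: sorted_list_of_set.idem_if_sorted_distinct strict_sorted_iff)
  then have "Q \<in> (\<lambda>Q. map North (sorted_list_of_set (set ls)) @ East # Q) ` east_ended a (S - set ls)"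
    using Q'(1) split by simp
  then show "Q \<in> ?R" using Q'(2) by blast
next
  fix Q assume "Q \<in> ?R"
  then obtain T Q' where T: "T \<subseteq> S" and Q': "Q' \<in> east_ended a (S - T)"
    and Q: "Q = map North (sorted_list_of_set T) @ East # Q'" by auto
  have "finite T" using T \<open>finite S\<close> by (rule finite_subset)
  then show "Q \<in> east_ended (Suc a) S"
    using T Q' unfolding Q
    by (auto simp: east_ended_def increasing_runs_append_East
        increasing_runs_map_North filter_map o_def)
qed

lemma finite_east_ended: "finite S \<Longrightarrow> finite (east_ended a S)"
  by (induction a arbitrary: S) (auto simp: east_ended_0 east_ended_Suc)

text \<open>Each label independently chooses one of \<open>a\<close> columns; the induction
  separates the labels in the first column from the rest.\<close>

lemma card_east_ended: "finite S \<Longrightarrow> card (east_ended a S) = a ^ card S"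
proof (induction a arbitrary: S)
  case 0
  \<comment> \<open>For empty \<open>S\<close> the value \<open>0 ^ 0 = 1\<close> counts the empty
    path.\<close>
  then show ?case by (auto simp: east_ended_0)
next
  case (Suc a)
  let ?f = "\<lambda>T Q. map North (sorted_list_of_set T) @ East # Q"
  have disj: "?f T ` A \<inter> ?f U ` B = {}" if "T \<in> Pow S" "U \<in> Pow S" "T \<noteq> U" for T U A B
  proof -
    \<comment> \<open>The initial north run recovers \<open>T\<close>, so different first columns
      give disjoint families.\<close>
    have tw: "takeWhile is_North (?f T Q) = map North (sorted_list_of_set T)" for T Q
      by (subst takeWhile_append2) auto
    have "T = U" if "?f T P = ?f U Q" for P Q
    proof -
      have "map North (sorted_list_of_set T) = map North (sorted_list_of_set U)"
        using that by (metis tw)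
      then have "sorted_list_of_set T = sorted_list_of_set U"
        by (metis north_labels_simps(5))
      then show ?thesis
        using \<open>T \<in> Pow S\<close> \<open>U \<in> Pow S\<close> \<open>finite S\<close>
        by (metis PowD finite_subset set_sorted_list_of_set)
    qed
    then show ?thesis using that(3) by auto
  qed
  have "card (east_ended (Suc a) S) = (\<Sum>T\<in>Pow S. card (?f T ` east_ended a (S - T)))"
    unfolding east_ended_Suc[OF \<open>finite S\<close>]
    using disj \<open>finite S\<close> by (intro card_UN_disjoint) (auto simp: finite_east_ended)
  also have "\<dots> = (\<Sum>T\<in>Pow S. a ^ card (S - T))"
    using Suc by (intro sum.cong) (auto simp: card_image inj_on_def)
  \<comment> \<open>Expanding the product picks 1 for the labels in \<open>T\<close> and
    \<open>a\<close> for those in \<open>S - T\<close>.\<close>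
  also have "\<dots> = (\<Prod>x\<in>S. 1 + a)"
    unfolding prod_add[OF \<open>finite S\<close>] by simp
  finally show ?case by simp
qed

section \<open>Last steps and labels of skeletal paths\<close>

text \<open>A final north step would start at level \<open>- a\<close>, since the path ends at level
  0, and (R1) constrains the last north step for every \<open>k\<close>.\<close>

lemma skeletal_last:
  assumes "a > 0" "skeletal a b k P"
  shows "last P = East"
proof (rule ccontr)
  assume "last P \<noteq> East"
  then have N: "is_North (last P)" by (simp flip: not_is_North_iff)
  have P: "P \<in> lattice_paths a b" and "R1 a b k P"
    using assms by (auto simp: skeletal_def)
  have len: "length P = a + b" using P by (rule lattice_paths_length)
  have "P \<noteq> []" using len \<open>a > 0\<close> by auto
  define i where "i = length P - 1"
  have i: "Suc i = length P" "P ! i = last P"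
    using \<open>P \<noteq> []\<close> by (auto simp: i_def last_conv_nth)
  have "[0..<length P] = [0..<i] @ [i]" using i(1) by (simp flip: i(1))
  then have "north_positions P = filter (\<lambda>i. is_North (P ! i)) [0..<i] @ [i]"
    using N i by (simp add: north_positions_def)
  then have "level a b (point_at P i) \<ge> 0"
    using \<open>R1 a b k P\<close> by (simp add: R1_def)
  moreover have "level a b (point_at P (Suc i)) = level a b (point_at P i) + int a"
  proof -
    have take: "take (Suc i) P = take i P @ [P ! i]"
      using i(1) by (intro take_Suc_conv_app_nth) simp
    show ?thesis using N i(2) unfolding level_eq_sum_list take by simp
  qed
  ultimately show False
    using level_end[OF P] len i \<open>a > 0\<close> by simp
qed

lemma last_underlying: "Q \<noteq> [] \<Longrightarrow> last (underlying Q) = East \<longleftrightarrow> last Q = East"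
  by (simp add: underlying_def last_map)

text \<open>All rotations of \<open>Q\<close> are labeled paths, so the claim reduces to the
  underlying path.\<close>

lemma ex1_skeletal_labeled_rotate:
  assumes Q: "Q \<in> labeled_paths a b" and "last Q = East" and "a > 0" and "coprime a b"
  shows "\<exists>!j. j < a + b \<and> skeletal_labeled a b k (rotate j Q)"
proof -
  have "underlying Q \<in> lattice_paths a b" using Q by (simp add: labeled_paths_def)
  then show ?thesis
    using ex1_skeletal_rotate \<open>a > 0\<close> \<open>coprime a b\<close> rotate_labeled_paths[OF Q \<open>last Q = East\<close>]
    by (simp add: skeletal_labeled_def)
qed

theorem theorem1p8:
  fixes a b k :: nat
  assumes "a > 0" and "b > 0" and "coprime a b" and "k < b"
  shows "(\<forall>P \<in> lattice_paths a b.
            \<exists>!Q. skeletal a b k Q \<and> (\<exists>v \<in> lattice_points P. Q = cyclic_shift P v))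
       \<and> real (card {Q \<in> lattice_paths a b. skeletal a b k Q})
            = 1 / real (a + b) * real ((a + b) choose a)
       \<and> (\<forall>Q \<in> labeled_paths a b. last Q = East \<longrightarrow>
            (\<exists>!R. skeletal_labeled a b k R \<and> (\<exists>v \<in> lattice_points Q. R = cyclic_shift Q v)))
       \<and> card {Q \<in> labeled_paths a b. skeletal_labeled a b k Q} = a ^ (b - 1)"
proof (intro conjI ballI impI)
  fix P assume P: "P \<in> lattice_paths a b"
  have len: "length P = a + b" using P by (rule lattice_paths_length)
  have "P \<noteq> []" using len \<open>a > 0\<close> by auto
  \<comment> \<open>Uniqueness of the position \<open>j\<close> is stronger than uniqueness of the
    shifted path.\<close>
  show "\<exists>!Q. skeletal a b k Q \<and> (\<exists>v \<in> lattice_points P. Q = cyclic_shift P v)"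
    unfolding ex_cyclic_shift_iff[OF \<open>P \<noteq> []\<close>] len
    using ex1_skeletal_rotate[OF P \<open>a > 0\<close> \<open>coprime a b\<close>, of k] by metis
next
  fix Q assume Q: "Q \<in> labeled_paths a b" "last Q = East"
  have len: "length Q = a + b" using Q(1) by (rule labeled_paths_length)
  have "Q \<noteq> []" using len \<open>a > 0\<close> by auto
  show "\<exists>!R. skeletal_labeled a b k R \<and> (\<exists>v \<in> lattice_points Q. R = cyclic_shift Q v)"
    unfolding ex_cyclic_shift_iff[OF \<open>Q \<noteq> []\<close>] len
    using ex1_skeletal_labeled_rotate[OF Q \<open>a > 0\<close> \<open>coprime a b\<close>, of k] by metis
next
  have sub: "{Q. skeletal a b k Q} \<subseteq> lattice_paths a b" by (auto simp: skeletal_def)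
  then have "card (lattice_paths a b) = card {Q. skeletal a b k Q} * (a + b)"
  proof (intro card_rotation_orbits)
    show "finite {Q. skeletal a b k Q}" using sub finite_lattice_paths by (rule finite_subset)
    show "card {i. i < a + b \<and> rotate i Q \<in> lattice_paths a b} = a + b" if "skeletal a b k Q" for Q
      using that sub by auto
  qed (use assms lattice_paths_length ex1_skeletal_rotate in auto)
  moreover have "{Q \<in> lattice_paths a b. skeletal a b k Q} = {Q. skeletal a b k Q}"
    using sub by auto
  ultimately show "real (card {Q \<in> lattice_paths a b. skeletal a b k Q})
            = 1 / real (a + b) * real ((a + b) choose a)"
    using \<open>a > 0\<close> by (simp add: card_lattice_paths)
next
  let ?X = "{Q \<in> labeled_paths a b. last Q = East}" and ?K = "skeletal_labeled a b k"
  have sub: "{Q. ?K Q} \<subseteq> labeled_paths a b" by (auto simp: skeletal_labeled_def)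
  have "card ?X = card {Q. ?K Q} * a"
  proof (rule card_rotation_orbits)
    show "finite {Q. ?K Q}" using sub finite_labeled_paths by (rule finite_subset)
    show "card {i. i < a + b \<and> rotate i R \<in> ?X} = a" if R: "?K R" for R
    proof -
      have lab: "R \<in> labeled_paths a b" using R sub by auto
      then have len: "length R = a + b" by (rule labeled_paths_length)
      then have "R \<noteq> []" using \<open>a > 0\<close> by auto
      then have "last R = East"
        using R skeletal_last[OF \<open>a > 0\<close>]
        by (auto simp: skeletal_labeled_def simp flip: last_underlying)
      \<comment> \<open>As \<open>R\<close> ends with an east step, all its rotations are labeled
        paths, and only the condition on the last step remains.\<close>
      then have "{i. i < a + b \<and> rotate i R \<in> ?X}
                   = {i. i < length R \<and> \<not> is_North (last (rotate i R))}"
        using rotate_labeled_paths[OF lab] len by (auto simp: not_is_North_iff)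
      then show ?thesis
        using lab card_rotations_last[OF \<open>R \<noteq> []\<close>, of "\<lambda>s. \<not> is_North s"]
        by (simp add: labeled_paths_iff)
    qed
  qed (use assms sub labeled_paths_length ex1_skeletal_labeled_rotate in auto)
  \<comment> \<open>Since \<open>a > 0\<close>, the empty path is in neither set.\<close>
  moreover have "?X = east_ended a {1..b}"
    using \<open>a > 0\<close> by (auto simp: labeled_paths_iff east_ended_def)
  ultimately have "card {Q. ?K Q} * a = a ^ b" by (simp add: card_east_ended)
  also have "\<dots> = a ^ (b - 1) * a" using \<open>b > 0\<close> by (simp only: power_minus_mult)
  finally have "card {Q. ?K Q} = a ^ (b - 1)" using \<open>a > 0\<close> by simp
  moreover have "{Q \<in> labeled_paths a b. ?K Q} = {Q. ?K Q}" using sub by auto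
  ultimately show "card {Q \<in> labeled_paths a b. ?K Q} = a ^ (b - 1)" by simp
qed

end
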